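(* For every graph $G$, the function $\gamma\mapsto f_G(\gamma)$ is concave on $\mathcal{P}_f(G)$; that is, for all $\gamma_1,\gamma_2\in\mathcal{P}_f(G)$ and all $\lambda\in[0,1]$, $f_G(\lambda\gamma_1+(1-\lambda)\gamma_2)\ge\lambda f_G(\gamma_1)+(1-\lambda)f_G(\gamma_2)$.
   Context: Graphs are finite, simple and undirected: $V(G)$ is a finite set and $E(G)$ is a set of 2-element subsets of $V(G)$. A fractional matching of $G$ is a function $\alpha:E(G)\to\mathbb{R}^{\ge 0}$ with $\sum_{e\ni v}\alpha(e)\le 1$ for every $v\in V(G)$; it is a fractional perfect matching if equality holds at every $v$. $\mathcal{P}_f(G)$ denotes the (convex) set of all fractional perfect matchings of $G$. Write $\|\alpha\|_1=\sum_{e\in E(G)}|\alpha(e)|$, and $\alpha\preceq\gamma$ if $\alpha(e)\le\gamma(e)$ for all $e\in E(G)$. For a fractional matching $\alpha$ and $\gamma\in\mathcal{P}_f(G)$, write $\alpha\uparrow\gamma$ ($\alpha$ is a forcing function for $\gamma$) if $\alpha\preceq\gamma$ and $\gamma$ is the only element $\gamma'$ of $\mathcal{P}_f(G)$ with $\alpha\preceq\gamma'$. The fractional forcing number of $\gamma$ is $f_G(\gamma)=\inf\{\|\alpha\|_1:\alpha\uparrow\gamma\}$. *)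

theory Defs
  imports Complex_Main
begin

definition finite_simple_graph :: "'a set \<Rightarrow> 'a set set \<Rightarrow> bool" where
  "finite_simple_graph V E \<longleftrightarrow> finite V \<and> E \<subseteq> {e. e \<subseteq> V \<and> card e = 2}"

(* A function E \<rightarrow> \<real> is encoded as a function on all sets of vertices that
   vanishes off E. Equality of functions is then equality on E, and the encoding
   is closed under pointwise linear combinations. *)
definition fractional_matching :: "'a set \<Rightarrow> 'a set set \<Rightarrow> ('a set \<Rightarrow> real) \<Rightarrow> bool" where
  "fractional_matching V E \<alpha> \<longleftrightarrow>
     (\<forall>e\<in>E. 0 \<le> \<alpha> e) \<and> (\<forall>e. e \<notin> E \<longrightarrow> \<alpha> e = 0) \<and>
     (\<forall>v\<in>V. (\<Sum>e | e \<in> E \<and> v \<in> e. \<alpha> e) \<le> 1)"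

definition fractional_perfect_matchings :: "'a set \<Rightarrow> 'a set set \<Rightarrow> ('a set \<Rightarrow> real) set" where
  "fractional_perfect_matchings V E =
     {\<alpha>. fractional_matching V E \<alpha> \<and> (\<forall>v\<in>V. (\<Sum>e | e \<in> E \<and> v \<in> e. \<alpha> e) = 1)}"

definition norm1 :: "'a set set \<Rightarrow> ('a set \<Rightarrow> real) \<Rightarrow> real" where
  "norm1 E \<alpha> = (\<Sum>e\<in>E. \<bar>\<alpha> e\<bar>)"

definition dominated :: "'a set set \<Rightarrow> ('a set \<Rightarrow> real) \<Rightarrow> ('a set \<Rightarrow> real) \<Rightarrow> bool" where
  "dominated E \<alpha> \<gamma> \<longleftrightarrow> (\<forall>e\<in>E. \<alpha> e \<le> \<gamma> e)"

definition forcing_function ::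
    "'a set \<Rightarrow> 'a set set \<Rightarrow> ('a set \<Rightarrow> real) \<Rightarrow> ('a set \<Rightarrow> real) \<Rightarrow> bool" where
  "forcing_function V E \<alpha> \<gamma> \<longleftrightarrow>
     fractional_matching V E \<alpha> \<and> \<gamma> \<in> fractional_perfect_matchings V E \<and>
     dominated E \<alpha> \<gamma> \<and>
     (\<forall>\<gamma>'\<in>fractional_perfect_matchings V E. dominated E \<alpha> \<gamma>' \<longrightarrow> \<gamma>' = \<gamma>)"

(* For a fractional perfect matching \<gamma> of a finite simple graph, the set below
   is bounded below by 0 and contains the norm of \<gamma> itself (which forces \<gamma>),
   so the real infimum is the true one. *)
definition fractional_forcing_number ::
    "'a set \<Rightarrow> 'a set set \<Rightarrow> ('a set \<Rightarrow> real) \<Rightarrow> real" where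
  "fractional_forcing_number V E \<gamma> = Inf {norm1 E \<alpha> | \<alpha>. forcing_function V E \<alpha> \<gamma>}"

end

theory Submission
  imports Defs
begin

text \<open>The number \<open>f\<^sub>G(\<gamma>)\<close> is a minimum of finitely many linear functions of \<open>\<gamma>\<close>, and any such
  minimum is concave.

  The linear functions come from the sets on which a forcing function is tight. Let
  \<open>S = {e. \<alpha> e = \<gamma> e}\<close> for a forcing function \<open>\<alpha>\<close> of \<open>\<gamma>\<close>. Two fractional perfect matchings differ
  by a weighting of the edges that sums to \<open>0\<close> at every vertex. Moving from \<open>\<gamma>\<close> a short way in the
  direction of such a weighting \<open>h\<close> stays above \<open>\<alpha>\<close> as soon as \<open>h \<ge> 0\<close> on \<open>S\<close>, because off \<open>S\<close>
  there is slack. So uniqueness of \<open>\<gamma>\<close> says that \<open>h = 0\<close> is the only such \<open>h\<close>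
  (\<open>tight_set_forces\<close>). This property of \<open>S\<close> no longer mentions \<open>\<gamma>\<close>, and conversely a set \<open>S\<close> with it
  makes the restriction \<open>\<delta>|S\<close> a forcing function for \<^emph>\<open>every\<close> fractional perfect matching \<open>\<delta>\<close>
  (\<open>restriction_forces\<close>). Since a forcing function weighs at least as much as its restriction
  to its tight set, where it agrees with \<open>\<gamma>\<close>, \<open>f\<^sub>G(\<gamma>) = min {\<gamma>(S)}\<close> over a family of edge
  sets \<open>S\<close> that depends on \<open>G\<close> alone.

  For the concavity inequality it suffices to take a forcing function \<open>\<alpha>\<close> of the convex combination
  and to use its tight set \<open>S\<close> to bound both \<open>f\<^sub>G(\<gamma>1)\<close> and \<open>f\<^sub>G(\<gamma>2)\<close> from above.\<close>

text \<open>These weightings form a linear space that contains the difference of any two fractional perfect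
  matchings.\<close>

definition balanced :: "'a set \<Rightarrow> 'a set set \<Rightarrow> ('a set \<Rightarrow> real) \<Rightarrow> bool" where
  "balanced V E h \<longleftrightarrow> (\<forall>e. e \<notin> E \<longrightarrow> h e = 0) \<and> (\<forall>v\<in>V. (\<Sum>e | e \<in> E \<and> v \<in> e. h e) = 0)"

definition forcing_set :: "'a set \<Rightarrow> 'a set set \<Rightarrow> 'a set set \<Rightarrow> bool" where
  "forcing_set V E S \<longleftrightarrow> (\<forall>h. balanced V E h \<longrightarrow> (\<forall>e\<in>S. 0 \<le> h e) \<longrightarrow> (\<forall>e. h e = 0))"

lemma fractional_perfect_matchings_iff:
  "\<gamma> \<in> fractional_perfect_matchings V E \<longleftrightarrow>
     (\<forall>e\<in>E. 0 \<le> \<gamma> e) \<and> (\<forall>e. e \<notin> E \<longrightarrow> \<gamma> e = 0) \<and>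
     (\<forall>v\<in>V. (\<Sum>e | e \<in> E \<and> v \<in> e. \<gamma> e) = 1)"
  by (auto simp: fractional_perfect_matchings_def fractional_matching_def)

lemma finite_edges: "finite_simple_graph V E \<Longrightarrow> finite E"
  by (rule finite_subset[of _ "Pow V"]) (auto simp: finite_simple_graph_def)

lemma balanced_diff:
  assumes "\<gamma> \<in> fractional_perfect_matchings V E" "\<gamma>' \<in> fractional_perfect_matchings V E"
  shows "balanced V E (\<lambda>e. \<gamma>' e - \<gamma> e)"
  using assms by (simp add: fractional_perfect_matchings_iff balanced_def sum_subtractf)

lemma perfect_matching_add_balanced:
  assumes "\<gamma> \<in> fractional_perfect_matchings V E" "balanced V E h" "\<forall>e\<in>E. 0 \<le> \<gamma> e + t * h e"
  shows "(\<lambda>e. \<gamma> e + t * h e) \<in> fractional_perfect_matchings V E"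
  using assms
  by (simp add: fractional_perfect_matchings_iff balanced_def sum.distrib flip: sum_distrib_left)

lemma perfect_matching_convex:
  assumes "\<gamma>1 \<in> fractional_perfect_matchings V E" "\<gamma>2 \<in> fractional_perfect_matchings V E"
    and "0 \<le> l" "l \<le> 1"
  shows "(\<lambda>e. l * \<gamma>1 e + (1 - l) * \<gamma>2 e) \<in> fractional_perfect_matchings V E"
  unfolding fractional_perfect_matchings_iff
proof (intro conjI)
  show "\<forall>v\<in>V. (\<Sum>e | e \<in> E \<and> v \<in> e. l * \<gamma>1 e + (1 - l) * \<gamma>2 e) = 1"
    using assms(1,2)
    by (simp add: fractional_perfect_matchings_iff sum.distrib flip: sum_distrib_left)
qed (use assms in \<open>auto simp: fractional_perfect_matchings_iff\<close>)

text \<open>Off the tight set every edge has positive slack, and there are finitely many edges, so a single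
  step length \<open>t > 0\<close> works for all of them.\<close>

lemma tight_set_forces:
  assumes fin: "finite E" and force: "forcing_function V E \<alpha> \<gamma>"
  shows "forcing_set V E {e\<in>E. \<alpha> e = \<gamma> e}"
  unfolding forcing_set_def
proof (intro allI impI)
  fix h e
  assume h: "balanced V E h" and pos: "\<forall>e\<in>{e\<in>E. \<alpha> e = \<gamma> e}. 0 \<le> h e"
  have alpha: "\<forall>e\<in>E. 0 \<le> \<alpha> e" and le: "\<forall>e\<in>E. \<alpha> e \<le> \<gamma> e"
    and gamma: "\<gamma> \<in> fractional_perfect_matchings V E"
    using force by (auto simp: forcing_function_def fractional_matching_def dominated_def)
  have unique: "\<gamma>' = \<gamma>"
    if "\<gamma>' \<in> fractional_perfect_matchings V E" "\<forall>e\<in>E. \<alpha> e \<le> \<gamma>' e" for \<gamma>'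
    using force that by (simp add: forcing_function_def dominated_def)
  have "\<forall>\<^sub>F t in at_right 0. \<alpha> e \<le> \<gamma> e + t * h e" if "e \<in> E" for e
  proof (cases "\<alpha> e = \<gamma> e")
    case True
    have "\<forall>\<^sub>F t::real in at_right 0. 0 < t" by (rule eventually_at_right_less)
    then show ?thesis by eventually_elim (use True pos that in simp)
  next
    case False
    then have "\<alpha> e < \<gamma> e" using le that by fastforce
    moreover have "((\<lambda>t. \<gamma> e + t * h e) \<longlongrightarrow> \<gamma> e + 0 * h e) (at_right 0)"
      by (intro tendsto_intros)
    ultimately have "\<forall>\<^sub>F t in at_right 0. \<alpha> e < \<gamma> e + t * h e"
      using order_tendstoD(1) by fastforce
    then show ?thesis by eventually_elim simp
  qed
  then have "\<forall>\<^sub>F t in at_right 0. \<forall>e\<in>E. \<alpha> e \<le> \<gamma> e + t * h e"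
    using fin by (simp add: eventually_ball_finite_distrib)
  moreover have "\<forall>\<^sub>F t::real in at_right 0. 0 < t" by (rule eventually_at_right_less)
  ultimately have "\<forall>\<^sub>F t in at_right 0. 0 < t \<and> (\<forall>e\<in>E. \<alpha> e \<le> \<gamma> e + t * h e)"
    by eventually_elim simp
  then obtain t where t: "0 < t" "\<forall>e\<in>E. \<alpha> e \<le> \<gamma> e + t * h e"
    using eventually_happens'[OF trivial_limit_at_right_real] by blast
  have "(\<lambda>e. \<gamma> e + t * h e) \<in> fractional_perfect_matchings V E"
    using t alpha by (intro perfect_matching_add_balanced gamma h) (meson order_trans)
  then have "(\<lambda>e. \<gamma> e + t * h e) = \<gamma>"
    by (rule unique) (rule t(2))
  then have "\<gamma> e + t * h e = \<gamma> e" by (rule fun_cong)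
  then show "h e = 0" using t by simp
qed

text \<open>If \<open>\<gamma>'\<close> dominates \<open>\<gamma>\<close> on \<open>S\<close>, then \<open>\<gamma>' - \<gamma>\<close> is a balanced weighting that is nonnegative on
  \<open>S\<close>. The only such weighting is \<open>0\<close>, whichever matching \<open>\<gamma>\<close> is.\<close>

lemma restriction_forces:
  assumes S: "forcing_set V E S" "S \<subseteq> E"
    and gamma: "\<gamma> \<in> fractional_perfect_matchings V E"
  shows "forcing_function V E (\<lambda>e. if e \<in> S then \<gamma> e else 0) \<gamma>"
proof -
  let ?\<alpha> = "\<lambda>e. if e \<in> S then \<gamma> e else 0"
  have nonneg: "\<forall>e\<in>E. 0 \<le> \<gamma> e"
    using gamma by (simp add: fractional_perfect_matchings_iff)
  have "(\<Sum>e | e \<in> E \<and> v \<in> e. ?\<alpha> e) \<le> 1" if "v \<in> V" for v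
  proof -
    have "(\<Sum>e | e \<in> E \<and> v \<in> e. ?\<alpha> e) \<le> (\<Sum>e | e \<in> E \<and> v \<in> e. \<gamma> e)"
      by (rule sum_mono) (use nonneg in auto)
    also have "\<dots> = 1" using gamma that by (simp add: fractional_perfect_matchings_iff)
    finally show ?thesis .
  qed
  then have "fractional_matching V E ?\<alpha>"
    using nonneg S by (auto simp: fractional_matching_def)
  moreover have "\<gamma>' = \<gamma>"
    if g: "\<gamma>' \<in> fractional_perfect_matchings V E" and dom: "dominated E ?\<alpha> \<gamma>'" for \<gamma>'
  proof -
    have "\<forall>e\<in>S. 0 \<le> \<gamma>' e - \<gamma> e" using dom S(2) by (fastforce simp: dominated_def)
    then have "\<forall>e. \<gamma>' e - \<gamma> e = 0"
      using S balanced_diff[OF gamma g] unfolding forcing_set_def by blast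
    then show ?thesis by (simp add: fun_eq_iff)
  qed
  ultimately show ?thesis
    using gamma nonneg by (auto simp: forcing_function_def dominated_def)
qed

lemma forcing_number_le_weight:
  assumes fin: "finite E" and S: "forcing_set V E S" "S \<subseteq> E"
    and gamma: "\<gamma> \<in> fractional_perfect_matchings V E"
  shows "fractional_forcing_number V E \<gamma> \<le> (\<Sum>e\<in>S. \<gamma> e)"
proof -
  let ?\<alpha> = "\<lambda>e. if e \<in> S then \<gamma> e else 0"
  have "norm1 E ?\<alpha> = (\<Sum>e\<in>E. if e \<in> S then \<gamma> e else 0)"
    using gamma by (auto simp: norm1_def fractional_perfect_matchings_iff intro!: sum.cong)
  also have "\<dots> = (\<Sum>e\<in>S. \<gamma> e)"
    using fin S by (simp add: sum.If_cases Int_absorb1)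
  finally have norm: "norm1 E ?\<alpha> = (\<Sum>e\<in>S. \<gamma> e)" .
  have "bdd_below {norm1 E \<alpha> | \<alpha>. forcing_function V E \<alpha> \<gamma>}"
    by (rule bdd_belowI[of _ 0]) (auto simp: norm1_def sum_nonneg)
  then have "fractional_forcing_number V E \<gamma> \<le> norm1 E ?\<alpha>"
    unfolding fractional_forcing_number_def
    using restriction_forces[OF S gamma] by (intro cInf_lower) blast+
  then show ?thesis by (simp only: norm)
qed

text \<open>A balanced weighting that is nonnegative everywhere vanishes on the edges at each vertex, and
  every edge has an end. This ensures that every fractional perfect matching has some forcing
  function, so that the infimum defining its forcing number is over a nonempty set.\<close>

lemma edge_set_forces:
  assumes graph: "finite_simple_graph V E"
  shows "forcing_set V E E"
  unfolding forcing_set_def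
proof (intro allI impI)
  fix h e
  assume h: "balanced V E h" and pos: "\<forall>e\<in>E. 0 \<le> h e"
  show "h e = 0"
  proof (cases "e \<in> E")
    case True
    then have "e \<subseteq> V" "e \<noteq> {}" using graph by (auto simp: finite_simple_graph_def)
    then obtain v where v: "v \<in> e" "v \<in> V" by blast
    then have "(\<Sum>e | e \<in> E \<and> v \<in> e. h e) = 0" using h by (simp add: balanced_def)
    then have "\<forall>e\<in>{e. e \<in> E \<and> v \<in> e}. h e = 0"
      using finite_edges[OF graph] pos by (subst (asm) sum_nonneg_eq_0_iff) auto
    then show ?thesis using True v by blast
  qed (use h in \<open>simp add: balanced_def\<close>)
qed

theorem theorem3p19:
  fixes V :: "'a set" and E :: "'a set set"
    and \<gamma>1 \<gamma>2 :: "'a set \<Rightarrow> real" and l :: real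
  assumes "finite_simple_graph V E"
    and "\<gamma>1 \<in> fractional_perfect_matchings V E"
    and "\<gamma>2 \<in> fractional_perfect_matchings V E"
    and "0 \<le> l" and "l \<le> 1"
  shows "fractional_forcing_number V E (\<lambda>e. l * \<gamma>1 e + (1 - l) * \<gamma>2 e) \<ge>
           l * fractional_forcing_number V E \<gamma>1 + (1 - l) * fractional_forcing_number V E \<gamma>2"
proof -
  let ?\<gamma> = "\<lambda>e. l * \<gamma>1 e + (1 - l) * \<gamma>2 e"
  let ?L = "l * fractional_forcing_number V E \<gamma>1 + (1 - l) * fractional_forcing_number V E \<gamma>2"
  have fin: "finite E" by (rule finite_edges) fact
  have gamma: "?\<gamma> \<in> fractional_perfect_matchings V E"
    using assms by (intro perfect_matching_convex)
  have bound: "?L \<le> norm1 E \<alpha>" if force: "forcing_function V E \<alpha> ?\<gamma>" for \<alpha>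
  proof -
    define S where "S = {e\<in>E. \<alpha> e = ?\<gamma> e}"
    have S: "forcing_set V E S" "S \<subseteq> E"
      using tight_set_forces[OF fin force] by (auto simp: S_def)
    have "?L \<le> l * (\<Sum>e\<in>S. \<gamma>1 e) + (1 - l) * (\<Sum>e\<in>S. \<gamma>2 e)"
      using assms S fin by (intro add_mono mult_left_mono forcing_number_le_weight) auto
    also have "\<dots> = (\<Sum>e\<in>S. ?\<gamma> e)" by (simp add: sum.distrib sum_distrib_left)
    also have "\<dots> = (\<Sum>e\<in>S. \<alpha> e)" by (rule sum.cong) (auto simp: S_def)
    also have "\<dots> \<le> (\<Sum>e\<in>S. \<bar>\<alpha> e\<bar>)" by (rule sum_mono) simp
    also have "\<dots> \<le> norm1 E \<alpha>"
      unfolding norm1_def using fin S by (intro sum_mono2) auto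
    finally show ?thesis .
  qed
  have "{norm1 E \<alpha> | \<alpha>. forcing_function V E \<alpha> ?\<gamma>} \<noteq> {}"
    using restriction_forces[OF edge_set_forces[OF assms(1)] order_refl gamma] by blast
  then show ?thesis
    unfolding fractional_forcing_number_def[of V E ?\<gamma>] using bound by (intro cInf_greatest) auto
qed

end
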